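(* Let $\mathfrak{C}$ and $\mathfrak{D}$ be classes of structures and let $F:\mathfrak{C}\to\mathfrak{D}$ be an enumerable functor. Then there is a computable functor $G:\mathfrak{C}\to\mathfrak{D}$ that is effectively isomorphic to $F$.
   Context: **Structures and classes.** Structures are in computable relational languages, have countable universe (taken to be a subset of $\omega$), and are identified with their atomic diagrams: the set of (Gödel numbers, under a fixed Gödel numbering, of) atomic sentences and negated atomic sentences, with names for the elements of the universe and including equalities $b=b$ for $b$ in the universe, that are true in the structure. A class of structures is a collection of structures in a common language closed under isomorphism, viewed as a category with isomorphisms as arrows. Functors are functors between such categories. **Enumerable functor.** An enumeration operator is a c.e. set $\Psi$ of pairs $(\alpha,b)$ with $\alpha\subseteq\omega$ finite and $b\in\omega$; $\Psi^X=\{b:(\exists\alpha\subseteq X)\,(\alpha,b)\in\Psi\}$ for $X\subseteq\omega$. A functor $F:\mathfrak{C}\to\mathfrak{D}$ is enumerable if there are an enumeration operator $\Psi$ and a Turing operator $\Phi_*$ with $\Psi^{\mathcal{A}}=F(\mathcal{A})$ for every $\mathcal{A}\in\mathfrak{C}$ and $\Phi_*^{\mathcal{A}\oplus f\oplus\mathcal{B}}=F(f)$ for every arrow $f:\mathcal{A}\to\mathcal{B}$ in $\mathfrak{C}$. **Computable functor.** A functor $G:\mathfrak{C}\to\mathfrak{D}$ is computable if there are Turing operators $\Phi,\Phi_*$ with $\Phi^{\mathcal{A}}=G(\mathcal{A})$ for every $\mathcal{A}\in\mathfrak{C}$ and $\Phi_*^{\mathcal{A}\oplus f\oplus\mathcal{B}}=G(f)$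 for every arrow $f:\mathcal{A}\to\mathcal{B}$ in $\mathfrak{C}$. **Effectively isomorphic.** Functors $F,G:\mathfrak{C}\to\mathfrak{D}$ (each either enumerable or computable) are effectively isomorphic if there is a Turing functional $\Lambda$ such that for every $\mathcal{A}\in\mathfrak{C}$, $\Lambda^{\mathcal{A}}$ is an isomorphism from $F(\mathcal{A})$ to $G(\mathcal{A})$, and $\Lambda^{\mathcal{B}}\circ F(h)=G(h)\circ\Lambda^{\mathcal{A}}$ for all $\mathcal{A},\mathcal{B}\in\mathfrak{C}$ and every arrow $h:\mathcal{A}\to\mathcal{B}$. *)

theory Defs
  imports Main "HOL-Library.Nat_Bijection"
begin

text \<open>
  Programs for functions that are partial recursive relative to an oracle. A program
  denotes a partial function on argument lists; \<^term>\<open>None\<close> stands for divergence, and also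
  for being applied to too few arguments.
\<close>

datatype prog =
    Zero
  | Succ
  | Proj nat
  | Oracle
  | Comp prog "prog list"
  | PrimRec prog prog
  | Mu prog

fun eval_prog :: "nat set \<Rightarrow> prog \<Rightarrow> nat list \<Rightarrow> nat option" where
  "eval_prog X Zero xs = Some 0"
| "eval_prog X Succ xs = (case xs of [] \<Rightarrow> None | x # _ \<Rightarrow> Some (Suc x))"
| "eval_prog X (Proj i) xs = (if i < length xs then Some (xs ! i) else None)"
| "eval_prog X Oracle xs = (case xs of [] \<Rightarrow> None | x # _ \<Rightarrow> Some (of_bool (x \<in> X)))"
| "eval_prog X (Comp p qs) xs =
     Option.bind (those (map (\<lambda>q. eval_prog X q xs) qs)) (\<lambda>ys. eval_prog X p ys)"
| "eval_prog X (PrimRec p q) xs =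
     (case xs of
        [] \<Rightarrow> None
      | n # ys \<Rightarrow> rec_nat (eval_prog X p ys)
                    (\<lambda>m r. Option.bind r (\<lambda>v. eval_prog X q (m # v # ys))) n)"
| "eval_prog X (Mu p) xs =
     (if \<exists>n. eval_prog X p (n # xs) = Some 0 \<and> (\<forall>m<n. eval_prog X p (m # xs) \<noteq> None)
      then Some (LEAST n. eval_prog X p (n # xs) = Some 0)
      else None)"

text \<open>A Turing operator is (given by) a program; applied to an oracle, it yields a unary
  partial function.\<close>

definition turing :: "prog \<Rightarrow> nat set \<Rightarrow> nat \<rightharpoonup> nat" where
  "turing p X = (\<lambda>n. eval_prog X p [n])"

definition char_fun :: "nat set \<Rightarrow> nat \<rightharpoonup> nat" where
  "char_fun Y = (\<lambda>n. Some (of_bool (n \<in> Y)))"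

definition computable_set :: "nat set \<Rightarrow> bool" where
  "computable_set Y \<longleftrightarrow> (\<exists>p. turing p {} = char_fun Y)"

definition ce_set :: "nat set \<Rightarrow> bool" where
  "ce_set Y \<longleftrightarrow> Y = {} \<or> (\<exists>p f. turing p {} = (\<lambda>n. Some (f n)) \<and> Y = range f)"

text \<open>\<^const>\<open>set_encode\<close> is the canonical index of a finite set.\<close>

definition enumeration_operator :: "(nat set \<times> nat) set \<Rightarrow> bool" where
  "enumeration_operator \<Psi> \<longleftrightarrow>
     (\<forall>(\<alpha>, b) \<in> \<Psi>. finite \<alpha>) \<and>
     ce_set ((\<lambda>(\<alpha>, b). prod_encode (set_encode \<alpha>, b)) ` \<Psi>)"

definition apply_enum :: "(nat set \<times> nat) set \<Rightarrow> nat set \<Rightarrow> nat set" where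
  "apply_enum \<Psi> X = {b. \<exists>\<alpha>. \<alpha> \<subseteq> X \<and> (\<alpha>, b) \<in> \<Psi>}"

definition join :: "nat set \<Rightarrow> nat set \<Rightarrow> nat set"  (infixl \<open>\<oplus>\<close> 65) where
  "X \<oplus> Y = sum_encode ` (X <+> Y)"


text \<open>Relation symbols are identified with natural numbers.\<close>

record lang =
  symbols :: "nat set"
  arity :: "nat \<Rightarrow> nat"

definition computable_lang :: "lang \<Rightarrow> bool" where
  "computable_lang L \<longleftrightarrow>
     computable_set (symbols L) \<and>
     (\<exists>p. \<forall>i \<in> symbols L. turing p {} i = Some (arity L i))"

record struct =
  universe :: "nat set"
  interp :: "nat \<Rightarrow> nat list set"

text \<open>The second and third condition make \<^const>\<open>interp\<close> carry no junk outside the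
  language, so that structures correspond to their atomic diagrams one-to-one.\<close>

definition is_struct :: "lang \<Rightarrow> struct \<Rightarrow> bool" where
  "is_struct L A \<longleftrightarrow>
     (\<forall>i \<in> symbols L. interp A i \<subseteq> {xs. length xs = arity L i \<and> set xs \<subseteq> universe A}) \<and>
     (\<forall>i. i \<notin> symbols L \<longrightarrow> interp A i = {})"

datatype atom = Equal nat nat | Rel nat "nat list"

datatype literal = Pos atom | Neg atom

fun atom_code :: "atom \<Rightarrow> nat" where
  "atom_code (Equal a b) = sum_encode (Inl (prod_encode (a, b)))"
| "atom_code (Rel i xs) = sum_encode (Inr (prod_encode (i, list_encode xs)))"

fun literal_code :: "literal \<Rightarrow> nat" where
  "literal_code (Pos p) = sum_encode (Inl (atom_code p))"
| "literal_code (Neg p) = sum_encode (Inr (atom_code p))"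

definition atomic_sentences :: "lang \<Rightarrow> nat set \<Rightarrow> atom set" where
  "atomic_sentences L U =
     {Equal a b | a b. a \<in> U \<and> b \<in> U} \<union>
     {Rel i xs | i xs. i \<in> symbols L \<and> length xs = arity L i \<and> set xs \<subseteq> U}"

fun holds :: "struct \<Rightarrow> atom \<Rightarrow> bool" where
  "holds A (Equal a b) \<longleftrightarrow> a = b"
| "holds A (Rel i xs) \<longleftrightarrow> xs \<in> interp A i"

definition diagram :: "lang \<Rightarrow> struct \<Rightarrow> nat set" where
  "diagram L A = literal_code `
     ({Pos p | p. p \<in> atomic_sentences L (universe A) \<and> holds A p} \<union>
      {Neg p | p. p \<in> atomic_sentences L (universe A) \<and> \<not> holds A p})"

lemma atom_code_inject [simp]: "atom_code p = atom_code q \<longleftrightarrow> p = q"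
  by (cases p; cases q) (auto simp: sum_encode_eq prod_encode_eq list_encode_eq)

lemma literal_code_inject [simp]: "literal_code p = literal_code q \<longleftrightarrow> p = q"
  by (cases p; cases q) (auto simp: sum_encode_eq)

lemma Pos_in_diagram:
  "literal_code (Pos p) \<in> diagram L A \<longleftrightarrow>
     p \<in> atomic_sentences L (universe A) \<and> holds A p"
  by (auto simp: diagram_def simp del: literal_code.simps)

lemma Neg_in_diagram:
  "literal_code (Neg p) \<in> diagram L A \<longleftrightarrow>
     p \<in> atomic_sentences L (universe A) \<and> \<not> holds A p"
  by (auto simp: diagram_def simp del: literal_code.simps)

lemma diagram_inject:
  assumes "is_struct L A" "is_struct L B" "diagram L A = diagram L B"
  shows "A = B"
proof -
  have pos: "p \<in> atomic_sentences L (universe A) \<and> holds A p \<longleftrightarrow>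
      p \<in> atomic_sentences L (universe B) \<and> holds B p" for p
    using assms(3) Pos_in_diagram by metis
  have U: "universe A = universe B"
    using pos[of "Equal a a" for a] by (auto simp: atomic_sentences_def)
  have "interp A i = interp B i" for i
  proof (cases "i \<in> symbols L")
    case True
    then show ?thesis
      using assms(1,2) pos[of "Rel i xs" for xs] U
      by (fastforce simp: is_struct_def atomic_sentences_def)
  next
    case False
    then show ?thesis using assms(1,2) by (simp add: is_struct_def)
  qed
  then have "interp A = interp B" by blast
  with U show ?thesis by simp
qed


text \<open>Arrows are partial functions whose domain is exactly the universe of the source.\<close>

definition isomorphism :: "lang \<Rightarrow> struct \<Rightarrow> struct \<Rightarrow> (nat \<rightharpoonup> nat) \<Rightarrow> bool" where
  "isomorphism L A B f \<longleftrightarrow>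
     dom f = universe A \<and>
     bij_betw (\<lambda>x. the (f x)) (universe A) (universe B) \<and>
     (\<forall>i \<in> symbols L. \<forall>xs. length xs = arity L i \<and> set xs \<subseteq> universe A \<longrightarrow>
        (xs \<in> interp A i \<longleftrightarrow> map (\<lambda>x. the (f x)) xs \<in> interp B i))"

definition struct_class :: "lang \<Rightarrow> struct set \<Rightarrow> bool" where
  "struct_class L C \<longleftrightarrow>
     computable_lang L \<and>
     (\<forall>A \<in> C. is_struct L A) \<and>
     (\<forall>A \<in> C. \<forall>B f. is_struct L B \<and> isomorphism L A B f \<longrightarrow> B \<in> C)"

definition id_arrow :: "struct \<Rightarrow> nat \<rightharpoonup> nat" where
  "id_arrow A = Some |` universe A"

text \<open>The action on arrows takes source and target as arguments, because an arrow in the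
  category is the partial function together with its source and target.\<close>

record sfunctor =
  obj :: "struct \<Rightarrow> struct"
  arr :: "struct \<Rightarrow> struct \<Rightarrow> (nat \<rightharpoonup> nat) \<Rightarrow> (nat \<rightharpoonup> nat)"

definition is_functor ::
    "lang \<Rightarrow> struct set \<Rightarrow> lang \<Rightarrow> struct set \<Rightarrow> sfunctor \<Rightarrow> bool" where
  "is_functor L C K D F \<longleftrightarrow>
     (\<forall>A \<in> C. obj F A \<in> D) \<and>
     (\<forall>A \<in> C. \<forall>B \<in> C. \<forall>f. isomorphism L A B f \<longrightarrow>
        isomorphism K (obj F A) (obj F B) (arr F A B f)) \<and>
     (\<forall>A \<in> C. arr F A A (id_arrow A) = id_arrow (obj F A)) \<and>
     (\<forall>A \<in> C. \<forall>B \<in> C. \<forall>E \<in> C. \<forall>f g. isomorphism L A B f \<and> isomorphism L B E g \<longrightarrow>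
        arr F A E (g \<circ>\<^sub>m f) = arr F B E g \<circ>\<^sub>m arr F A B f)"

definition arrow_oracle :: "lang \<Rightarrow> struct \<Rightarrow> (nat \<rightharpoonup> nat) \<Rightarrow> struct \<Rightarrow> nat set" where
  "arrow_oracle L A f B = diagram L A \<oplus> prod_encode ` Map.graph f \<oplus> diagram L B"

text \<open>An operator computes the image of an arrow as a partial function, so it diverges
  outside the universe of the image of the source.\<close>

definition computes_arrows :: "lang \<Rightarrow> struct set \<Rightarrow> sfunctor \<Rightarrow> prog \<Rightarrow> bool" where
  "computes_arrows L C F p \<longleftrightarrow>
     (\<forall>A \<in> C. \<forall>B \<in> C. \<forall>f. isomorphism L A B f \<longrightarrow>
        turing p (arrow_oracle L A f B) = arr F A B f)"

definition enumerable_functor ::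
    "lang \<Rightarrow> struct set \<Rightarrow> lang \<Rightarrow> struct set \<Rightarrow> sfunctor \<Rightarrow> bool" where
  "enumerable_functor L C K D F \<longleftrightarrow>
     is_functor L C K D F \<and>
     (\<exists>\<Psi> p. enumeration_operator \<Psi> \<and>
        (\<forall>A \<in> C. apply_enum \<Psi> (diagram L A) = diagram K (obj F A)) \<and>
        computes_arrows L C F p)"

definition computable_functor ::
    "lang \<Rightarrow> struct set \<Rightarrow> lang \<Rightarrow> struct set \<Rightarrow> sfunctor \<Rightarrow> bool" where
  "computable_functor L C K D G \<longleftrightarrow>
     is_functor L C K D G \<and>
     (\<exists>p q. (\<forall>A \<in> C. turing p (diagram L A) = char_fun (diagram K (obj G A))) \<and>
        computes_arrows L C G q)"

definition effectively_isomorphic ::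
    "lang \<Rightarrow> struct set \<Rightarrow> lang \<Rightarrow> sfunctor \<Rightarrow> sfunctor \<Rightarrow> bool" where
  "effectively_isomorphic L C K F G \<longleftrightarrow>
     (\<exists>p. (\<forall>A \<in> C. isomorphism K (obj F A) (obj G A) (turing p (diagram L A))) \<and>
        (\<forall>A \<in> C. \<forall>B \<in> C. \<forall>h. isomorphism L A B h \<longrightarrow>
           turing p (diagram L B) \<circ>\<^sub>m arr F A B h = arr G A B h \<circ>\<^sub>m turing p (diagram L A)))"

end

theory Submission
  imports Defs
begin

text \<open>
  The diagram of \<open>F(A)\<close> is enumerated by stages, uniformly and computably in the diagram of \<open>A\<close>.
  An element of \<open>F(A)\<close> is renamed to the first stage at which the sentence \<open>a = a\<close> for it
  appears. The set of these stages is decidable in \<open>A\<close>, unlike the universe of \<open>F(A)\<close>, and a relation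
  on them is decided by waiting for the atomic sentence about the named elements or for its
  negation. The renaming and its inverse are partial computable in \<open>A\<close>, so conjugating \<open>F\<close> with
  them yields a computable functor.
\<close>

section \<open>Relativisation\<close>

text \<open>Using \<open>Proj 0\<close> in the \<open>Oracle\<close> case keeps divergence on an
  empty argument list and hands \<open>r\<close> the first argument only.\<close>

primrec subst_oracle :: "prog \<Rightarrow> prog \<Rightarrow> prog" where
  "subst_oracle r Zero = Zero"
| "subst_oracle r Succ = Succ"
| "subst_oracle r (Proj i) = Proj i"
| "subst_oracle r Oracle = Comp r [Proj 0]"
| "subst_oracle r (Comp p qs) = Comp (subst_oracle r p) (map (subst_oracle r) qs)"
| "subst_oracle r (PrimRec p q) = PrimRec (subst_oracle r p) (subst_oracle r q)"
| "subst_oracle r (Mu p) = Mu (subst_oracle r p)"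

text \<open>Serves two purposes: running a program for the source or the target structure on an
  oracle for an arrow, and, with \<open>r = Zero\<close>, freeing an oracle-less computation from
  the oracle it is run with.\<close>

lemma eval_subst_oracle:
  assumes r: "\<And>x. eval_prog X r [x] = Some (of_bool (x \<in> Y))"
  shows "eval_prog X (subst_oracle r p) xs = eval_prog Y p xs"
proof (induction p arbitrary: xs)
  case (Comp p qs)
  have "map (\<lambda>q. eval_prog X q xs) (map (subst_oracle r) qs) = map (\<lambda>q. eval_prog Y q xs) qs"
    using Comp.IH(2) by simp
  moreover have "eval_prog X (subst_oracle r p) = eval_prog Y p"
    using Comp.IH(1) by blast
  ultimately show ?case
    by (simp only: subst_oracle.simps eval_prog.simps)
next
  case (PrimRec p q)
  then show ?case by (simp cong: list.case_cong)
qed (auto simp: r split: list.split)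

corollary eval_subst_oracle_empty: "eval_prog X (subst_oracle Zero p) xs = eval_prog {} p xs"
  by (rule eval_subst_oracle) simp


section \<open>Arithmetic programs\<close>

primrec const_prog :: "nat \<Rightarrow> prog" where
  "const_prog 0 = Zero"
| "const_prog (Suc n) = Comp Succ [const_prog n]"

lemma eval_const_prog [simp]: "eval_prog X (const_prog n) xs = Some n"
  by (induction n) auto

text \<open>Recursion is on the first argument. The step finds the counter at index 0, the previous
  value at index 1 and the parameters from index 2 on.\<close>

definition "add_prog = PrimRec (Proj 0) (Comp Succ [Proj 1])"

lemma eval_add_prog [simp]: "eval_prog X add_prog [m, n] = Some (m + n)"
  by (induction m) (auto simp: add_prog_def)

definition "pred_prog = PrimRec Zero (Proj 0)"

lemma eval_pred_prog [simp]: "eval_prog X pred_prog [n] = Some (n - 1)"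
  by (induction n) (auto simp: pred_prog_def)

definition "sub_prog = Comp (PrimRec (Proj 0) (Comp pred_prog [Proj 1])) [Proj 1, Proj 0]"

lemma eval_sub_prog [simp]: "eval_prog X sub_prog [m, n] = Some (m - n)"
  by (induction n) (auto simp: sub_prog_def)

definition "not_prog = Comp sub_prog [const_prog 1, Proj 0]"

lemma eval_not_prog [simp]: "eval_prog X not_prog [a] = Some (of_bool (a = 0))"
  by (simp add: not_prog_def)

definition "or_prog = Comp not_prog [Comp not_prog [add_prog]]"

lemma eval_or_prog [simp]: "eval_prog X or_prog [a, b] = Some (of_bool (a \<noteq> 0 \<or> b \<noteq> 0))"
  by (simp add: or_prog_def)

definition "and_prog = Comp not_prog [Comp or_prog [Comp not_prog [Proj 0], Comp not_prog [Proj 1]]]"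

lemma eval_and_prog [simp]: "eval_prog X and_prog [a, b] = Some (of_bool (a \<noteq> 0 \<and> b \<noteq> 0))"
  by (simp add: and_prog_def)

definition "less_prog = Comp not_prog [Comp not_prog [Comp sub_prog [Proj 1, Proj 0]]]"

lemma eval_less_prog [simp]: "eval_prog X less_prog [a, b] = Some (of_bool (a < b))"
  by (auto simp: less_prog_def)

definition "eq_prog = Comp not_prog [Comp or_prog [less_prog, Comp less_prog [Proj 1, Proj 0]]]"

lemma eval_eq_prog [simp]: "eval_prog X eq_prog [a, b] = Some (of_bool (a = b))"
  by (auto simp: eq_prog_def)

definition "parity_prog = Comp (PrimRec Zero (Comp not_prog [Proj 1])) [Proj 0]"

lemma eval_parity_prog [simp]: "eval_prog X parity_prog [n] = Some (n mod 2)"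
proof -
  have "eval_prog X (PrimRec Zero (Comp not_prog [Proj 1])) [n] = Some (n mod 2)"
    by (induction n) (auto simp: mod_Suc)
  then show ?thesis by (simp add: parity_prog_def)
qed

definition "half_prog = PrimRec Zero (Comp add_prog [Proj 1, Comp parity_prog [Proj 0]])"

lemma eval_half_prog [simp]: "eval_prog X half_prog [n] = Some (n div 2)"
proof (induction n)
  case (Suc n)
  have "n div 2 + n mod 2 = Suc n div 2" by presburger
  then show ?case using Suc by (simp add: half_prog_def)
qed (simp add: half_prog_def)

definition "shift_prog = PrimRec (Proj 0) (Comp half_prog [Proj 1])"

lemma eval_shift_prog [simp]: "eval_prog X shift_prog [k, n] = Some (n div 2 ^ k)"
proof (induction k)
  case (Suc k)
  have "n div 2 ^ k div 2 = n div (2 * 2 ^ k)"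
    by (metis div_mult2_eq mult.commute)
  then show ?case using Suc by (simp add: shift_prog_def)
qed (simp add: shift_prog_def)

definition "triangle_prog = PrimRec Zero (Comp add_prog [Proj 1, Comp Succ [Proj 0]])"

lemma eval_triangle_prog [simp]: "eval_prog X triangle_prog [n] = Some (triangle n)"
  by (induction n) (auto simp: triangle_prog_def)

lemma mono_triangle: "mono triangle"
  by (simp add: mono_iff_le_Suc)

text \<open>The Cantor code of \<open>(a, b)\<close> is \<open>triangle (a + b) + a\<close>, which
  lies below \<open>triangle (Suc (a + b))\<close>. Hence the least \<open>s\<close> with code below
  \<open>triangle (Suc s)\<close> is \<open>a + b\<close>. The condition is negated because
  \<open>Mu\<close> searches for a zero.\<close>

definition "diagonal_prog =
  Mu (Comp not_prog [Comp less_prog [Proj 1, Comp triangle_prog [Comp Succ [Proj 0]]]])"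

lemma eval_diagonal_prog [simp]:
  "eval_prog X diagonal_prog [prod_encode (a, b)] = Some (a + b)"
proof -
  let ?n = "prod_encode (a, b)"
  have below: "\<not> ?n < triangle (Suc s)" if "s < a + b" for s
    using monoD[OF mono_triangle, of "Suc s" "a + b"] that
    by (simp add: prod_encode_def del: triangle_Suc)
  have at: "?n < triangle (Suc (a + b))"
    by (simp add: prod_encode_def)
  have "(LEAST s. ?n < triangle (Suc s)) = a + b"
    using at below by (intro Least_equality) (auto simp: not_less[symmetric] simp del: triangle_Suc)
  then show ?thesis
    using at by (auto simp: diagonal_prog_def simp del: triangle_Suc)
qed

definition "fst_prog = Comp sub_prog [Proj 0, Comp triangle_prog [diagonal_prog]]"

lemma eval_fst_prog [simp]: "eval_prog X fst_prog [n] = Some (fst (prod_decode n))"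
proof -
  obtain a b where "n = prod_encode (a, b)"
    by (metis prod_decode_inverse surj_pair)
  then show ?thesis
    by (simp add: fst_prog_def) (simp add: prod_encode_def)
qed

definition "snd_prog = Comp sub_prog [diagonal_prog, fst_prog]"

lemma eval_snd_prog [simp]: "eval_prog X snd_prog [n] = Some (snd (prod_decode n))"
proof -
  obtain a b where "n = prod_encode (a, b)"
    by (metis prod_decode_inverse surj_pair)
  then show ?thesis by (simp add: snd_prog_def)
qed


section \<open>Bounded quantifiers and guards\<close>

lemma those_map_eq_Some:
  "(\<And>q. q \<in> set qs \<Longrightarrow> h q = Some (g q)) \<Longrightarrow> those (map h qs) = Some (map g qs)"
  by (induction qs) auto

text \<open>The offset 2 skips the counter and the previous value in the step of a recursion. The
  number of parameters has to be fixed, as no program denotes the rest of its argument list.\<close>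

definition tail_projs :: "nat \<Rightarrow> prog list" where
  "tail_projs k = map (\<lambda>i. Proj (i + 2)) [0..<k]"

lemma those_eval_tail_projs:
  assumes "length ys = k"
  shows "those (map (\<lambda>q. eval_prog X q (m # v # ys)) (tail_projs k)) = Some ys"
proof -
  have "those (map (\<lambda>i. eval_prog X (Proj (i + 2)) (m # v # ys)) [0..<k]) =
      Some (map (\<lambda>i. ys ! i) [0..<k])"
    using assms by (intro those_map_eq_Some) auto
  then show ?thesis
    using assms map_nth[of ys] by (simp add: tail_projs_def comp_def)
qed

definition all_prog :: "nat \<Rightarrow> prog \<Rightarrow> prog" where
  "all_prog k p = PrimRec (const_prog 1) (Comp and_prog [Proj 1, Comp p (Proj 0 # tail_projs k)])"

text \<open>The conjunction does not stop early at a failure, so \<open>p\<close> must converge at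
  every index below the bound.\<close>

lemma eval_all_prog:
  assumes "length ys = k" "\<And>j. j < b \<Longrightarrow> eval_prog X p (j # ys) \<noteq> None"
  shows "eval_prog X (all_prog k p) (b # ys) =
    Some (of_bool (\<forall>j<b. eval_prog X p (j # ys) \<noteq> Some 0))"
  using assms(2)
proof (induction b)
  case (Suc b)
  then obtain v where v: "eval_prog X p (b # ys) = Some v" by blast
  have "eval_prog X (all_prog k p) (b # ys) =
      Some (of_bool (\<forall>j<b. eval_prog X p (j # ys) \<noteq> Some 0))"
    using Suc by simp
  then show ?case
    using v those_eval_tail_projs[OF assms(1)]
    by (simp add: all_prog_def All_less_Suc conj_commute)
qed (simp add: all_prog_def)

text \<open>Composition evaluates all of its arguments, so a subprogram that may diverge has to be
  run as the step of a recursion which is entered only if the condition holds.\<close>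

definition guard_prog :: "nat \<Rightarrow> prog \<Rightarrow> prog" where
  "guard_prog k p = PrimRec Zero (Comp p (tail_projs k))"

lemma eval_guard_prog:
  assumes "length ys = k" "c \<le> 1"
  shows "eval_prog X (guard_prog k p) (c # ys) = (if c = 0 then Some 0 else eval_prog X p ys)"
proof -
  consider "c = 0" | "c = 1" using assms(2) by linarith
  then show ?thesis
    using those_eval_tail_projs[OF assms(1)] by cases (simp_all add: guard_prog_def)
qed


section \<open>Finite sets and lists\<close>

lemma less_if_in_set_decode:
  assumes "n \<in> set_decode a"
  shows "n < a"
proof -
  have "2 ^ n \<le> a"
    using assms by (cases "a < 2 ^ n") (auto simp: set_decode_def)
  then show ?thesis
    using less_exp[of n] by linarith
qed

text \<open>Members of a finite set are smaller than its canonical index, so the index serves both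
  as the bound and as the parameter of the quantifier. Thus applicability of an axiom takes finitely
  many oracle queries.\<close>

definition "subset_prog = Comp (all_prog 1
  (Comp or_prog [Comp not_prog [Comp parity_prog [shift_prog]], Oracle])) [Proj 0, Proj 0]"

lemma eval_subset_prog [simp]:
  "eval_prog X subset_prog [a] = Some (of_bool (set_decode a \<subseteq> X))"
proof -
  have "set_decode a \<subseteq> X \<longleftrightarrow> (\<forall>n<a. a div 2 ^ n mod 2 = 0 \<or> n \<in> X)"
    unfolding subset_iff using less_if_in_set_decode
    by (metis set_decode_def mem_Collect_eq even_iff_mod_2_eq_zero)
  then show ?thesis
    by (simp add: subset_prog_def eval_all_prog)
qed

text \<open>A nonempty list is coded as the successor of a pair of head and tail code. Since
  \<open>prod_decode 0 = (0, 0)\<close>, the code 0 of the empty list is a fixed point, so dropping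
  past the end is harmless.\<close>

definition drop_code :: "nat \<Rightarrow> nat \<Rightarrow> nat" where
  "drop_code j c = rec_nat c (\<lambda>_ v. snd (prod_decode (v - 1))) j"

definition nth_code :: "nat \<Rightarrow> nat \<Rightarrow> nat" where
  "nth_code c j = fst (prod_decode (drop_code j c - 1))"

lemma prod_decode_0: "prod_decode 0 = (0, 0)"
  by (simp add: prod_decode_def prod_decode_aux.simps)

lemma drop_code_list_encode: "drop_code j (list_encode xs) = list_encode (drop j xs)"
proof (induction j)
  case (Suc j)
  have "snd (prod_decode (list_encode ys - 1)) = list_encode (tl ys)" for ys
    by (cases ys) (auto simp: prod_decode_0)
  then show ?case
    using Suc by (simp add: drop_code_def drop_Suc tl_drop)
qed (simp add: drop_code_def)

lemma nth_code_eq: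
  assumes "j < length (list_decode c)"
  shows "nth_code c j = list_decode c ! j"
proof -
  have "drop_code j c = list_encode (list_decode c ! j # drop (Suc j) (list_decode c))"
    using drop_code_list_encode[of j "list_decode c"] assms by (simp add: Cons_nth_drop_Suc)
  then show ?thesis by (simp add: nth_code_def)
qed

definition "drop_prog = PrimRec (Proj 0) (Comp snd_prog [Comp pred_prog [Proj 1]])"

lemma eval_drop_prog [simp]: "eval_prog X drop_prog [j, c] = Some (drop_code j c)"
  by (induction j) (auto simp: drop_prog_def drop_code_def)

definition "nth_prog = Comp fst_prog [Comp pred_prog [Comp drop_prog [Proj 1, Proj 0]]]"

lemma eval_nth_prog [simp]: "eval_prog X nth_prog [c, j] = Some (nth_code c j)"
  by (simp add: nth_prog_def nth_code_def)

text \<open>The length is the first number of drops that reaches the code 0 of the empty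
  list.\<close>

definition "length_prog = Mu drop_prog"

lemma eval_length_prog [simp]: "eval_prog X length_prog [c] = Some (length (list_decode c))"
proof -
  have "drop_code j c = 0 \<longleftrightarrow> length (list_decode c) \<le> j" for j
    using drop_code_list_encode[of j "list_decode c"] list_encode_eq[of "drop j (list_decode c)" "[]"]
    by simp
  moreover have "(LEAST j. length (list_decode c) \<le> j) = length (list_decode c)"
    by (rule Least_equality) auto
  ultimately show ?thesis by (auto simp: length_prog_def)
qed


section \<open>Stages\<close>

definition "double_prog = Comp add_prog [Proj 0, Proj 0]"

lemma eval_double_prog [simp]: "eval_prog X double_prog [n] = Some (2 * n)"
  by (simp add: double_prog_def)

definition "pair_prog = Comp add_prog [Comp triangle_prog [add_prog], Proj 0]"

lemma eval_pair_prog [simp]: "eval_prog X pair_prog [a, b] = Some (prod_encode (a, b))"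
  by (simp add: pair_prog_def prod_encode_def)

text \<open>Replaces comparison with an encoded list by tests on the decoded parts, which is how
  \<open>match_prog\<close> proceeds.\<close>

lemma atom_code_eq_Rel_iff:
  "c = atom_code (Rel i xs) \<longleftrightarrow> c mod 2 = 1 \<and> fst (prod_decode (c div 2)) = i \<and>
     list_decode (snd (prod_decode (c div 2))) = xs"
proof
  assume "c mod 2 = 1 \<and> fst (prod_decode (c div 2)) = i \<and>
     list_decode (snd (prod_decode (c div 2))) = xs"
  then have "prod_encode (i, list_encode xs) = c div 2" "c mod 2 = 1"
    by auto
  then show "c = atom_code (Rel i xs)"
    by (simp add: sum_encode_def) presburger
qed (auto simp: sum_encode_def)

text \<open>Stage \<open>n\<close> is the axiom coded by \<open>f n\<close>: a canonical index of a
  finite set, paired with an output. The program must work under every oracle \<open>X\<close>,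
  because the list of axioms does not depend on the input structure.\<close>

locale stage_enumeration =
  fixes pf :: prog and f :: "nat \<Rightarrow> nat"
  assumes eval_pf [simp]: "eval_prog X pf [n] = Some (f n)"
begin

definition out :: "nat \<Rightarrow> nat" where
  "out n = snd (prod_decode (f n))"

definition fires :: "nat set \<Rightarrow> nat \<Rightarrow> bool" where
  "fires X n \<longleftrightarrow> set_decode (fst (prod_decode (f n))) \<subseteq> X"

definition enumerated :: "nat set \<Rightarrow> nat set" where
  "enumerated X = {out n | n. fires X n}"

text \<open>The code of a positive equality is four times the code of the pair, so division by 4
  removes sign and kind of the atom. On other outputs the value is meaningless; \<open>fresh\<close>
  checks the form of the output.\<close>

definition elt :: "nat \<Rightarrow> nat" where
  "elt n = fst (prod_decode (out n div 4))"

text \<open>Only stages up to \<open>n\<close> are consulted, so this is decidable from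
  \<open>X\<close>, whereas membership of an element in the enumerated structure is merely
  enumerable.\<close>

definition fresh :: "nat set \<Rightarrow> nat \<Rightarrow> bool" where
  "fresh X n \<longleftrightarrow> fires X n \<and> out n = literal_code (Pos (Equal (elt n) (elt n))) \<and>
     (\<forall>m<n. \<not> fires X m \<or> out m \<noteq> out n)"

text \<open>\<open>None\<close> stands for the divergence of the search for an element that never
  appears.\<close>

definition stage :: "nat set \<Rightarrow> nat \<rightharpoonup> nat" where
  "stage X a =
     (if \<exists>n. fresh X n \<and> elt n = a then Some (LEAST n. fresh X n \<and> elt n = a) else None)"

definition fresh_elt :: "nat set \<Rightarrow> nat \<rightharpoonup> nat" where
  "fresh_elt X n = (if fresh X n then Some (elt n) else None)"

definition "out_prog = Comp snd_prog [pf]"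

lemma eval_out_prog [simp]: "eval_prog X out_prog [n] = Some (out n)"
  by (simp add: out_prog_def out_def)

definition "fires_prog = Comp subset_prog [Comp fst_prog [pf]]"

lemma eval_fires_prog [simp]: "eval_prog X fires_prog [n] = Some (of_bool (fires X n))"
  by (simp add: fires_prog_def fires_def)

definition "elt_prog = Comp fst_prog [Comp half_prog [Comp half_prog [out_prog]]]"

lemma eval_elt_prog [simp]: "eval_prog X elt_prog [n] = Some (elt n)"
  by (simp add: elt_prog_def elt_def flip: div_mult2_eq)

definition "fresh_prog = Comp and_prog [fires_prog, Comp and_prog [
  Comp eq_prog [out_prog, Comp double_prog [Comp double_prog [Comp pair_prog [elt_prog, elt_prog]]]],
  Comp (all_prog 1 (Comp or_prog [Comp not_prog [Comp fires_prog [Proj 0]],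
    Comp not_prog [Comp eq_prog [Comp out_prog [Proj 0], Comp out_prog [Proj 1]]]])) [Proj 0, Proj 0]]]"

lemma eval_fresh_prog [simp]: "eval_prog X fresh_prog [n] = Some (of_bool (fresh X n))"
  by (simp add: fresh_prog_def fresh_def eval_all_prog sum_encode_def)

definition "stage_prog = Mu (Comp not_prog [Comp and_prog [Comp fresh_prog [Proj 0],
  Comp eq_prog [Comp elt_prog [Proj 0], Proj 1]]])"

lemma eval_stage_prog [simp]: "eval_prog X stage_prog [a] = stage X a"
  by (simp add: stage_prog_def stage_def)

text \<open>The search stops at once or diverges, depending on whether the argument is fresh.\<close>

definition "fresh_elt_prog = Comp elt_prog [Comp add_prog [Proj 0,
  Mu (Comp not_prog [Comp fresh_prog [Proj 1]])]]"

lemma eval_fresh_elt_prog [simp]: "eval_prog X fresh_elt_prog [n] = fresh_elt X n"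
  by (simp add: fresh_elt_prog_def fresh_elt_def)

text \<open>The arguments are a stage, a relation symbol and the code of a list of names. Halving
  the output discards the sign, so a sentence and its negation both match.\<close>

definition "match_prog = Comp and_prog [Comp fires_prog [Proj 0],
  (let c = Comp half_prog [Comp out_prog [Proj 0]];
       i = Comp fst_prog [Comp half_prog [c]];
       ys = Comp snd_prog [Comp half_prog [c]]
   in Comp and_prog [Comp parity_prog [c],
        Comp and_prog [Comp eq_prog [i, Proj 1],
          Comp and_prog [
            Comp eq_prog [Comp length_prog [ys], Comp length_prog [Proj 2]],
            Comp (all_prog 2 (Comp eq_prog [Comp nth_prog [Proj 1, Proj 0],
               Comp elt_prog [Comp nth_prog [Proj 2, Proj 0]]]))
              [Comp length_prog [Proj 2], ys, Proj 2]]]])]"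

lemma eval_match_prog [simp]:
  "eval_prog X match_prog [n, i, w] =
    Some (of_bool (fires X n \<and> out n div 2 = atom_code (Rel i (map elt (list_decode w)))))"
proof -
  have "ys = map elt xs \<longleftrightarrow> length ys = length xs \<and> (\<forall>j<length xs. ys ! j = elt (xs ! j))"
    for ys xs
    by (auto simp: list_eq_iff_nth_eq)
  then show ?thesis
    by (auto simp: match_prog_def Let_def eval_all_prog atom_code_eq_Rel_iff nth_code_eq
        simp del: atom_code.simps)
qed

end

section \<open>The copy on fresh stages\<close>

context stage_enumeration
begin

text \<open>Equal elements yield the same output, and only one stage can be the first to produce
  it.\<close>

lemma fresh_inj: "fresh X m \<Longrightarrow> fresh X n \<Longrightarrow> elt m = elt n \<Longrightarrow> m = n"
  unfolding fresh_def by (metis nat_neq_iff)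

lemma ex_fresh_iff:
  "(\<exists>n. fresh X n \<and> elt n = a) \<longleftrightarrow> literal_code (Pos (Equal a a)) \<in> enumerated X"
proof
  assume "literal_code (Pos (Equal a a)) \<in> enumerated X"
  then have ex: "\<exists>n. fires X n \<and> out n = literal_code (Pos (Equal a a))"
    by (auto simp: enumerated_def)
  define n where "n = (LEAST n. fires X n \<and> out n = literal_code (Pos (Equal a a)))"
  have n: "fires X n \<and> out n = literal_code (Pos (Equal a a))"
    unfolding n_def by (rule LeastI_ex[OF ex])
  moreover have "\<not> fires X m \<or> out m \<noteq> out n" if "m < n" for m
    using not_less_Least[OF that[unfolded n_def]] n by auto
  moreover have "elt n = a"
    using n by (simp add: elt_def sum_encode_def)
  ultimately show "\<exists>n. fresh X n \<and> elt n = a"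
    unfolding fresh_def by metis
next
  assume "\<exists>n. fresh X n \<and> elt n = a"
  then show "literal_code (Pos (Equal a a)) \<in> enumerated X"
    unfolding fresh_def enumerated_def by (metis (mono_tags, lifting) mem_Collect_eq)
qed

text \<open>By \<open>fresh_inj\<close> the minimum is taken over at most one candidate; hence
  \<open>stage X\<close> and \<open>fresh_elt X\<close> invert each other.\<close>

lemma stage_eq_Some_iff: "stage X a = Some n \<longleftrightarrow> fresh X n \<and> elt n = a"
proof -
  have "(LEAST n. fresh X n \<and> elt n = a) = m" if "fresh X m" "elt m = a" for m
    using that LeastI[of "\<lambda>n. fresh X n \<and> elt n = a" m] fresh_inj by blast
  then show ?thesis by (auto simp: stage_def)
qed

text \<open>The pullback of \<open>B\<close> along \<open>elt\<close>. The side conditions make it a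
  structure for any \<open>B\<close>.\<close>

definition copy :: "lang \<Rightarrow> nat set \<Rightarrow> struct \<Rightarrow> struct" where
  "copy K X B = \<lparr>universe = {n. fresh X n},
     interp = (\<lambda>i. {xs. i \<in> symbols K \<and> length xs = arity K i \<and> (\<forall>x \<in> set xs. fresh X x) \<and>
       map elt xs \<in> interp B i})\<rparr>"

lemma is_struct_copy: "is_struct K (copy K X B)"
  by (auto simp: is_struct_def copy_def)

end

text \<open>In the application \<open>X\<close> is the diagram of \<open>A\<close> and
  \<open>B\<close> is the image of \<open>A\<close> under \<open>F\<close>.\<close>

locale enumerated_diagram = stage_enumeration +
  fixes K :: lang and X :: "nat set" and B :: struct
  assumes enumerated_eq: "enumerated X = diagram K B"
begin

lemma ex_fresh_iff_universe: "(\<exists>n. fresh X n \<and> elt n = a) \<longleftrightarrow> a \<in> universe B"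
  unfolding ex_fresh_iff enumerated_eq Pos_in_diagram by (auto simp: atomic_sentences_def)

lemma universe_eq: "universe B = elt ` {n. fresh X n}"
  by (auto simp flip: ex_fresh_iff_universe)

lemma fresh_elt_comp_stage: "fresh_elt X \<circ>\<^sub>m stage X = id_arrow B"
proof
  fix a
  show "(fresh_elt X \<circ>\<^sub>m stage X) a = id_arrow B a"
  proof (cases "stage X a")
    case None
    then have "a \<notin> universe B"
      using stage_eq_Some_iff ex_fresh_iff_universe by (metis option.distinct(1))
    then show ?thesis using None by (simp add: id_arrow_def)
  next
    case (Some n)
    then have "fresh X n" "elt n = a" "a \<in> universe B"
      using stage_eq_Some_iff ex_fresh_iff_universe by metis+
    then show ?thesis using Some by (simp add: id_arrow_def fresh_elt_def)
  qed
qed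

lemma stage_comp_fresh_elt: "stage X \<circ>\<^sub>m fresh_elt X = id_arrow (copy K X B)"
proof
  fix n
  show "(stage X \<circ>\<^sub>m fresh_elt X) n = id_arrow (copy K X B) n"
    using stage_eq_Some_iff[of X "elt n" n]
    by (simp add: map_comp_def fresh_elt_def id_arrow_def copy_def)
qed

lemma isomorphism_fresh_elt: "isomorphism K (copy K X B) B (fresh_elt X)"
proof -
  have "bij_betw elt {n. fresh X n} (universe B)"
    using fresh_inj by (auto simp: bij_betw_def inj_on_def universe_eq)
  moreover have "the (fresh_elt X n) = elt n" if "n \<in> {n. fresh X n}" for n
    using that by (simp add: fresh_elt_def)
  ultimately have "bij_betw (\<lambda>n. the (fresh_elt X n)) {n. fresh X n} (universe B)"
    by (subst bij_betw_cong[where g = elt]) auto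
  moreover have "xs \<in> interp (copy K X B) i \<longleftrightarrow> map (\<lambda>n. the (fresh_elt X n)) xs \<in> interp B i"
    if "i \<in> symbols K" "length xs = arity K i" "set xs \<subseteq> {n. fresh X n}" for i xs
  proof -
    have "map (\<lambda>n. the (fresh_elt X n)) xs = map elt xs"
      using that(3) by (auto simp: fresh_elt_def)
    moreover have "xs \<in> interp (copy K X B) i \<longleftrightarrow> map elt xs \<in> interp B i"
      using that by (auto simp: copy_def)
    ultimately show ?thesis by metis
  qed
  moreover have "dom (fresh_elt X) = {n. fresh X n}"
    by (auto simp: dom_def fresh_elt_def)
  ultimately show ?thesis
    by (simp add: isomorphism_def copy_def)
qed

lemma isomorphism_stage: "isomorphism K B (copy K X B) (stage X)"
proof -
  have stage_elt: "stage X (elt n) = Some n" if "fresh X n" for n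
    using that stage_eq_Some_iff by blast
  have "dom (stage X) = universe B"
    using stage_eq_Some_iff ex_fresh_iff_universe by (auto simp: dom_def)
  moreover have "bij_betw (\<lambda>x. the (stage X x)) (universe B) {n. fresh X n}"
    unfolding universe_eq by (rule bij_betw_byWitness[where f' = elt]) (auto simp: stage_elt)
  moreover have "xs \<in> interp B i \<longleftrightarrow> map (\<lambda>x. the (stage X x)) xs \<in> interp (copy K X B) i"
    if "i \<in> symbols K" "length xs = arity K i" "set xs \<subseteq> universe B" for i xs
  proof -
    have "\<forall>x \<in> set xs. fresh X (the (stage X x)) \<and> elt (the (stage X x)) = x"
      using that(3) unfolding universe_eq by (auto simp: stage_elt)
    moreover from this have "map (elt \<circ> (\<lambda>x. the (stage X x))) xs = xs"
      by (intro map_idI) auto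
    ultimately show ?thesis
      using that by (auto simp: copy_def)
  qed
  ultimately show ?thesis
    by (simp add: isomorphism_def copy_def)
qed

text \<open>Soundness of waiting: only true literals are enumerated, so the sign of any literal on
  \<open>p\<close> reveals its truth value.\<close>

lemma literal_of_match:
  assumes "fires X n" "out n div 2 = atom_code p"
  shows "p \<in> atomic_sentences K (universe B) \<and> (out n mod 2 = 0 \<longleftrightarrow> holds B p)"
proof -
  have mem: "out n \<in> diagram K B"
    using assms(1) by (auto simp: enumerated_def simp flip: enumerated_eq)
  show ?thesis
  proof (cases "out n mod 2 = 0")
    case True
    then have "out n = literal_code (Pos p)"
      using assms(2) div_mult_mod_eq[of "out n" 2] by (simp add: sum_encode_def)
    then show ?thesis using mem True Pos_in_diagram by metis
  next
    case False
    then have "out n = literal_code (Neg p)"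
      using assms(2) div_mult_mod_eq[of "out n" 2] by (simp add: sum_encode_def)
    then show ?thesis using mem False Neg_in_diagram by metis
  qed
qed

text \<open>Completeness of waiting: a diagram contains every atomic sentence or its negation, so
  the search stops.\<close>

lemma ex_match:
  assumes "p \<in> atomic_sentences K (universe B)"
  shows "\<exists>n. fires X n \<and> out n div 2 = atom_code p"
proof -
  have "literal_code (Pos p) \<in> enumerated X \<or> literal_code (Neg p) \<in> enumerated X"
    using assms unfolding enumerated_eq Pos_in_diagram Neg_in_diagram by blast
  then obtain n where "fires X n" "out n = literal_code (Pos p) \<or> out n = literal_code (Neg p)"
    by (auto simp: enumerated_def simp del: literal_code.simps)
  then show ?thesis by (auto simp: sum_encode_def)
qed

end

section \<open>Deciding the diagram of the copy\<close>

text \<open>In the code of a literal, bit 0 is set iff the literal is negative and bit 1 is set iff its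
  atom is relational. The next two programs take the arguments \<open>[s, i, w]\<close>, where \<open>s\<close> is bit 0
  and the atom is \<open>Rel i (list_decode w)\<close> or \<open>Equal i w\<close>.\<close>

context stage_enumeration
begin

definition "relation_prog sp ap = Comp (guard_prog 3 (Comp (guard_prog 3
    (Comp eq_prog [Proj 0, Comp parity_prog [Comp out_prog [
      Mu (Comp not_prog [Comp match_prog [Proj 0, Proj 2, Proj 3]])]]]))
    [Comp and_prog [Comp eq_prog [Comp length_prog [Proj 2], Comp ap [Proj 1]],
      Comp (all_prog 1 (Comp fresh_prog [Comp nth_prog [Proj 1, Proj 0]]))
        [Comp length_prog [Proj 2], Proj 2]],
     Proj 0, Proj 1, Proj 2]))
  [Comp sp [Proj 1], Proj 0, Proj 1, Proj 2]"

definition "equality_prog = Comp and_prog [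
  Comp and_prog [Comp fresh_prog [Proj 1], Comp fresh_prog [Proj 2]],
  Comp eq_prog [Proj 0, Comp not_prog [Comp eq_prog [Proj 1, Proj 2]]]]"

text \<open>Bit 1 of the input opens exactly one of the two guards; the closed one contributes 0 to
  the disjunction.\<close>

definition "diagram_prog sp ap =
  (let d = Comp half_prog [Proj 0];
       args = [Comp parity_prog [Proj 0], Comp fst_prog [Comp half_prog [d]],
         Comp snd_prog [Comp half_prog [d]]]
   in Comp or_prog [
     Comp (guard_prog 3 (relation_prog sp ap)) (Comp parity_prog [d] # args),
     Comp (guard_prog 3 equality_prog) (Comp not_prog [Comp parity_prog [d]] # args)])"

end

context enumerated_diagram
begin

text \<open>Equality in the copy is equality of stage numbers, so no search is involved.\<close>

lemma eval_equality_prog: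
  "eval_prog X equality_prog [s, a, b] =
    Some (of_bool (Equal a b \<in> atomic_sentences K (universe (copy K X B)) \<and>
      s = of_bool (\<not> holds (copy K X B) (Equal a b))))"
  by (auto simp: equality_prog_def atomic_sentences_def copy_def)

text \<open>The cases follow the two nested guards. The arity program may diverge off the symbols,
  so it runs only after \<open>sp\<close> accepts \<open>i\<close>; the unbounded search runs only
  for fresh stages of the right number, where \<open>ex_match\<close> makes it stop.\<close>

lemma eval_relation_prog:
  assumes sp: "\<And>i. eval_prog X sp [i] = Some (of_bool (i \<in> symbols K))"
    and ap: "\<And>i. i \<in> symbols K \<Longrightarrow> eval_prog X ap [i] = Some (arity K i)"
  shows "eval_prog X (relation_prog sp ap) [s, i, w] =
    Some (of_bool (Rel i (list_decode w) \<in> atomic_sentences K (universe (copy K X B)) \<and>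
      s = of_bool (\<not> holds (copy K X B) (Rel i (list_decode w)))))"
proof -
  define xs where "xs = list_decode w"
  have all_fresh: "(\<forall>j<length xs. fresh X (nth_code w j)) \<longleftrightarrow> set xs \<subseteq> {n. fresh X n}"
    using nth_code_eq[of _ w] by (auto simp: xs_def set_conv_nth)
  consider "i \<notin> symbols K" | "i \<in> symbols K" "\<not> (length xs = arity K i \<and> set xs \<subseteq> {n. fresh X n})"
    | "i \<in> symbols K" "length xs = arity K i" "set xs \<subseteq> {n. fresh X n}"
    by blast
  then show ?thesis
  proof cases
    case 1
    then show ?thesis
      by (simp add: relation_prog_def sp eval_guard_prog atomic_sentences_def)
  next
    case 2
    then have "\<not> (length xs = arity K i \<and> (\<forall>j<length xs. fresh X (nth_code w j)))"
      by (simp add: all_fresh)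
    then show ?thesis
      using 2 unfolding xs_def
      by (auto simp: relation_prog_def sp ap eval_guard_prog eval_all_prog atomic_sentences_def copy_def)
  next
    case 3
    let ?p = "Rel i (map elt xs)"
    define n where "n = (LEAST n. fires X n \<and> out n div 2 = atom_code ?p)"
    have holds_copy: "xs \<in> interp (copy K X B) i \<longleftrightarrow> map elt xs \<in> interp B i"
      using 3 by (auto simp: copy_def)
    have atomic: "Rel i xs \<in> atomic_sentences K (universe (copy K X B))"
      using 3 by (auto simp: atomic_sentences_def copy_def)
    have "elt ` set xs \<subseteq> universe B"
      using 3(3) universe_eq by blast
    then have "?p \<in> atomic_sentences K (universe B)"
      using 3 by (auto simp: atomic_sentences_def)
    then have ex: "\<exists>n. fires X n \<and> out n div 2 = atom_code ?p"
      by (rule ex_match)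
    then have "fires X n \<and> out n div 2 = atom_code ?p"
      unfolding n_def by (rule LeastI_ex)
    then have "out n mod 2 = 0 \<longleftrightarrow> map elt xs \<in> interp B i"
      using literal_of_match[of n ?p] by (simp del: atom_code.simps)
    then have sign: "out n mod 2 = of_bool (\<not> map elt xs \<in> interp B i)"
      by auto
    have "eval_prog X (Mu (Comp not_prog [Comp match_prog [Proj 0, Proj 2, Proj 3]])) [s, i, w] = Some n"
      using ex by (simp add: n_def xs_def del: atom_code.simps)
    moreover have "\<forall>j<length xs. fresh X (nth_code w j)"
      using 3 all_fresh by simp
    ultimately show ?thesis
      using 3 atomic sign holds_copy unfolding xs_def
      by (simp add: relation_prog_def sp ap eval_guard_prog eval_all_prog del: eval_prog.simps(7))
  qed
qed

lemma turing_diagram_prog: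
  assumes sp: "\<And>i. eval_prog X sp [i] = Some (of_bool (i \<in> symbols K))"
    and ap: "\<And>i. i \<in> symbols K \<Longrightarrow> eval_prog X ap [i] = Some (arity K i)"
  shows "turing (diagram_prog sp ap) X = char_fun (diagram K (copy K X B))"
proof
  fix c :: nat
  define s where "s = c mod 2"
  define d where "d = c div 2"
  define i where "i = fst (prod_decode (d div 2))"
  define w where "w = snd (prod_decode (d div 2))"
  define p where "p = (if d mod 2 = 1 then Rel i (list_decode w) else Equal i w)"
  \<comment> \<open>All the encodings are bijective, so every number codes a literal and decoding
    meets no ill-formed input.\<close>
  have "d = atom_code p"
    unfolding p_def i_def w_def by (simp add: sum_encode_def) presburger
  moreover have "c = 2 * d + s"
    unfolding d_def s_def by simp
  moreover have "s = 0 \<or> s = 1"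
    unfolding s_def by linarith
  ultimately have "c = literal_code (if s = 0 then Pos p else Neg p)"
    by (auto simp: sum_encode_def simp del: atom_code.simps)
  then have "c \<in> diagram K (copy K X B) \<longleftrightarrow>
      p \<in> atomic_sentences K (universe (copy K X B)) \<and> s = of_bool (\<not> holds (copy K X B) p)"
    using \<open>s = 0 \<or> s = 1\<close> Pos_in_diagram Neg_in_diagram
    by (auto simp del: literal_code.simps)
  moreover have "eval_prog X (diagram_prog sp ap) [c] = Some (of_bool
      (p \<in> atomic_sentences K (universe (copy K X B)) \<and> s = of_bool (\<not> holds (copy K X B) p)))"
    by (simp add: diagram_prog_def Let_def eval_guard_prog eval_equality_prog
        eval_relation_prog[OF sp ap] p_def flip: s_def d_def i_def w_def)
  ultimately show "turing (diagram_prog sp ap) X c = char_fun (diagram K (copy K X B)) c"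
    by (simp add: turing_def char_fun_def)
qed

end


section \<open>Functors\<close>

lemma isomorphism_comp:
  assumes "isomorphism L A B f" "isomorphism L B E g"
  shows "isomorphism L A E (g \<circ>\<^sub>m f)"
proof -
  have f: "f x = Some (the (f x))" "the (f x) \<in> universe B" if "x \<in> universe A" for x
  proof -
    have "x \<in> dom f"
      using assms(1) that by (simp add: isomorphism_def)
    then show "f x = Some (the (f x))" by auto
    show "the (f x) \<in> universe B"
      using assms(1) that by (auto simp: isomorphism_def bij_betw_def)
  qed
  have g: "g x = Some (the (g x))" if "x \<in> universe B" for x
  proof -
    have "x \<in> dom g"
      using assms(2) that by (simp add: isomorphism_def)
    then show ?thesis by auto
  qed
  have comp: "the ((g \<circ>\<^sub>m f) x) = the (g (the (f x)))" if "x \<in> universe A" for x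
    using f[OF that] by (metis map_comp_simps(2))
  have "x \<in> dom (g \<circ>\<^sub>m f) \<longleftrightarrow> x \<in> universe A" for x
  proof (cases "x \<in> universe A")
    case True
    then show ?thesis
      using f[OF True] g[of "the (f x)"] by (metis domI map_comp_simps(2))
  next
    case False
    then have "f x = None" using assms(1) by (auto simp: isomorphism_def)
    then show ?thesis using False by auto
  qed
  then have "dom (g \<circ>\<^sub>m f) = universe A" by blast
  moreover have "bij_betw (\<lambda>x. the ((g \<circ>\<^sub>m f) x)) (universe A) (universe E)"
  proof -
    have "bij_betw ((\<lambda>x. the (g x)) \<circ> (\<lambda>x. the (f x))) (universe A) (universe E)"
      using assms by (auto simp: isomorphism_def intro: bij_betw_trans)
    then show ?thesis
      by (subst bij_betw_cong[where g = "(\<lambda>x. the (g x)) \<circ> (\<lambda>x. the (f x))"]) (auto simp: comp)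
  qed
  moreover have "xs \<in> interp A i \<longleftrightarrow> map (\<lambda>x. the ((g \<circ>\<^sub>m f) x)) xs \<in> interp E i"
    if "i \<in> symbols L" "length xs = arity L i" "set xs \<subseteq> universe A" for i xs
  proof -
    let ?ys = "map (\<lambda>x. the (f x)) xs"
    have "set ?ys \<subseteq> universe B" using that(3) f(2) by auto
    then have "?ys \<in> interp B i \<longleftrightarrow> map (\<lambda>x. the (g x)) ?ys \<in> interp E i"
      using assms(2) that unfolding isomorphism_def by (metis length_map)
    moreover have "xs \<in> interp A i \<longleftrightarrow> ?ys \<in> interp B i"
      using assms(1) that unfolding isomorphism_def by blast
    moreover have "map (\<lambda>x. the (g x)) ?ys = map (\<lambda>x. the ((g \<circ>\<^sub>m f) x)) xs"
      using that(3) by (auto simp: comp)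
    ultimately show ?thesis by metis
  qed
  ultimately show ?thesis by (simp add: isomorphism_def)
qed

lemma map_comp_assoc: "(h \<circ>\<^sub>m g) \<circ>\<^sub>m f = h \<circ>\<^sub>m (g \<circ>\<^sub>m f)"
  by (auto simp: map_comp_def split: option.split)

lemma map_comp_id_arrow:
  assumes "dom f = universe A"
  shows "f \<circ>\<^sub>m id_arrow A = f"
proof
  fix x
  have "x \<notin> universe A \<Longrightarrow> f x = None"
    using assms by blast
  then show "(f \<circ>\<^sub>m id_arrow A) x = f x"
    by (cases "x \<in> universe A") (auto simp: id_arrow_def map_comp_def)
qed

lemma id_arrow_map_comp:
  assumes "isomorphism L A B f"
  shows "id_arrow B \<circ>\<^sub>m f = f"
proof
  fix x
  show "(id_arrow B \<circ>\<^sub>m f) x = f x"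
  proof (cases "f x")
    case (Some y)
    then have "y \<in> universe B"
      using assms by (force simp: isomorphism_def bij_betw_def dom_def)
    then show ?thesis using Some by (simp add: id_arrow_def)
  qed simp
qed

text \<open>Transport of structure: in a composite of conjugated arrows the inner \<open>u B\<close>
  after \<open>t B\<close> cancels, leaving the conjugate of the composite.\<close>

lemma is_functor_conjugate:
  assumes F: "is_functor L C K D F"
    and H: "\<And>A. A \<in> C \<Longrightarrow> H A \<in> D"
    and t: "\<And>A. A \<in> C \<Longrightarrow> isomorphism K (obj F A) (H A) (t A)"
    and u: "\<And>A. A \<in> C \<Longrightarrow> isomorphism K (H A) (obj F A) (u A)"
    and ut: "\<And>A. A \<in> C \<Longrightarrow> u A \<circ>\<^sub>m t A = id_arrow (obj F A)"
    and tu: "\<And>A. A \<in> C \<Longrightarrow> t A \<circ>\<^sub>m u A = id_arrow (H A)"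
  shows "is_functor L C K D \<lparr>obj = H, arr = (\<lambda>A B h. t B \<circ>\<^sub>m (arr F A B h \<circ>\<^sub>m u A))\<rparr>"
proof -
  have "isomorphism K (H A) (H B) (t B \<circ>\<^sub>m (arr F A B h \<circ>\<^sub>m u A))"
    if "A \<in> C" "B \<in> C" "isomorphism L A B h" for A B h
    using F t[OF that(2)] u[OF that(1)] that
    by (intro isomorphism_comp[where B = "obj F A"] isomorphism_comp[where B = "obj F B"])
      (auto simp: is_functor_def)
  moreover have "t A \<circ>\<^sub>m (arr F A A (id_arrow A) \<circ>\<^sub>m u A) = id_arrow (H A)" if "A \<in> C" for A
    using F that tu id_arrow_map_comp[OF u] by (simp add: is_functor_def)
  moreover have "t E \<circ>\<^sub>m (arr F A E (g \<circ>\<^sub>m h) \<circ>\<^sub>m u A) =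
      (t E \<circ>\<^sub>m (arr F B E g \<circ>\<^sub>m u B)) \<circ>\<^sub>m (t B \<circ>\<^sub>m (arr F A B h \<circ>\<^sub>m u A))"
    if "A \<in> C" "B \<in> C" "E \<in> C" "isomorphism L A B h" "isomorphism L B E g" for A B E g h
  proof -
    have iso: "isomorphism K (obj F A) (obj F B) (arr F A B h)"
      using F that by (simp add: is_functor_def)
    have "(t E \<circ>\<^sub>m (arr F B E g \<circ>\<^sub>m u B)) \<circ>\<^sub>m (t B \<circ>\<^sub>m (arr F A B h \<circ>\<^sub>m u A)) =
        t E \<circ>\<^sub>m (arr F B E g \<circ>\<^sub>m (((u B \<circ>\<^sub>m t B) \<circ>\<^sub>m arr F A B h) \<circ>\<^sub>m u A))"
      by (simp add: map_comp_assoc)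
    also have "\<dots> = t E \<circ>\<^sub>m ((arr F B E g \<circ>\<^sub>m arr F A B h) \<circ>\<^sub>m u A)"
      by (simp add: ut that id_arrow_map_comp[OF iso] map_comp_assoc)
    also have "arr F B E g \<circ>\<^sub>m arr F A B h = arr F A E (g \<circ>\<^sub>m h)"
      using F that unfolding is_functor_def by metis
    finally show ?thesis by simp
  qed
  ultimately show ?thesis
    using H by (auto simp: is_functor_def)
qed

section \<open>From enumeration operators to stages\<close>

text \<open>If the operator has no axioms at all, it is replaced by one whose only axiom requires
  \<^term>\<open>literal_code (Neg (Equal 0 0)) = 1\<close>, which is false in every structure.\<close>

lemma one_notin_diagram: "1 \<notin> diagram L A"
proof -
  have "1 = literal_code (Neg (Equal 0 0))"
    by (simp add: sum_encode_def prod_encode_def)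
  then show ?thesis
    using Neg_in_diagram[of "Equal 0 0" L A] by (metis holds.simps(1))
qed

text \<open>A nonempty c.e. set of axioms is the range of a total computable function, which
  supplies the stages. The equation is restricted to diagrams because the substitute axiom for the
  empty operator does apply to oracles containing 1.\<close>

lemma enumeration_operator_stages:
  assumes "enumeration_operator \<Psi>"
  obtains pf f where "stage_enumeration pf f"
    "\<And>L A. stage_enumeration.enumerated f (diagram L A) = apply_enum \<Psi> (diagram L A)"
proof (cases "\<Psi> = {}")
  case True
  let ?n = "prod_encode (set_encode {1}, 0)"
  interpret stage_enumeration "const_prog ?n" "\<lambda>_. ?n"
    by standard simp
  have "\<not> fires (diagram L A) n" for L A n
    unfolding fires_def prod_encode_inverse fst_conv
      set_encode_inverse[OF finite.insertI[OF finite.emptyI]]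
    using one_notin_diagram by blast
  then have "enumerated (diagram L A) = apply_enum \<Psi> (diagram L A)" for L A
    using True unfolding enumerated_def apply_enum_def by blast
  then show ?thesis
    using that stage_enumeration_axioms by blast
next
  case False
  let ?code = "\<lambda>(\<alpha>, b). prod_encode (set_encode \<alpha>, b)"
  have fin: "finite \<alpha>" if "(\<alpha>, b) \<in> \<Psi>" for \<alpha> b
    using assms that by (auto simp: enumeration_operator_def)
  obtain p f where p: "turing p {} = (\<lambda>n. Some (f n))" and f: "?code ` \<Psi> = range f"
    using assms False by (auto simp: enumeration_operator_def ce_set_def)
  interpret stage_enumeration "subst_oracle Zero p" f
    by standard (use p in \<open>simp add: eval_subst_oracle_empty turing_def fun_eq_iff\<close>)
  have "b \<in> enumerated X \<longleftrightarrow> b \<in> apply_enum \<Psi> X" for X b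
  proof
    assume "b \<in> enumerated X"
    then obtain n where n: "out n = b" "fires X n"
      by (auto simp: enumerated_def)
    have "f n \<in> ?code ` \<Psi>" using f by simp
    then obtain \<alpha> b' where "(\<alpha>, b') \<in> \<Psi>" "f n = prod_encode (set_encode \<alpha>, b')"
      by auto
    then show "b \<in> apply_enum \<Psi> X"
      using n fin by (auto simp: out_def fires_def apply_enum_def)
  next
    assume "b \<in> apply_enum \<Psi> X"
    then obtain \<alpha> where \<alpha>: "\<alpha> \<subseteq> X" "(\<alpha>, b) \<in> \<Psi>"
      by (auto simp: apply_enum_def)
    then have "?code (\<alpha>, b) \<in> range f" using f by blast
    then obtain n where "f n = prod_encode (set_encode \<alpha>, b)" by auto
    then have "out n = b" "fires X n"
      using \<alpha> fin by (auto simp: out_def fires_def)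
    then show "b \<in> enumerated X" by (auto simp: enumerated_def)
  qed
  then have "enumerated X = apply_enum \<Psi> X" for X by blast
  then show ?thesis
    using that stage_enumeration_axioms by blast
qed

text \<open>The join associates to the left, so the source diagram sits at the multiples of 4 and
  the target diagram at the odd numbers; the graph of the arrow occupies the rest.\<close>

definition "source_oracle_prog = Comp Oracle [Comp double_prog [double_prog]]"
definition "target_oracle_prog = Comp Oracle [Comp Succ [double_prog]]"

lemma in_arrow_oracle:
  "4 * x \<in> arrow_oracle L A h B \<longleftrightarrow> x \<in> diagram L A"
  "Suc (2 * x) \<in> arrow_oracle L A h B \<longleftrightarrow> x \<in> diagram L B"
proof -
  have "4 * x = sum_encode (Inl (sum_encode (Inl x)))" "Suc (2 * x) = sum_encode (Inr x)"
    by (simp_all add: sum_encode_def)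
  then show "4 * x \<in> arrow_oracle L A h B \<longleftrightarrow> x \<in> diagram L A"
    "Suc (2 * x) \<in> arrow_oracle L A h B \<longleftrightarrow> x \<in> diagram L B"
    by (simp_all only: arrow_oracle_def join_def) (auto simp: sum_encode_eq)
qed

lemma eval_source_oracle_prog:
  "eval_prog (arrow_oracle L A h B) source_oracle_prog [x] = Some (of_bool (x \<in> diagram L A))"
  using in_arrow_oracle(1)[of x] by (simp add: source_oracle_prog_def)

lemma eval_target_oracle_prog:
  "eval_prog (arrow_oracle L A h B) target_oracle_prog [x] = Some (of_bool (x \<in> diagram L B))"
  using in_arrow_oracle(2)[of x] by (simp add: target_oracle_prog_def)

theorem theorem2:
  fixes L K :: lang and C D :: "struct set" and F :: sfunctor
  assumes "struct_class L C"
    and "struct_class K D"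
    and "enumerable_functor L C K D F"
  shows "\<exists>G. computable_functor L C K D G \<and> effectively_isomorphic L C K F G"
proof -
  obtain \<Psi> pF where F: "is_functor L C K D F" and \<Psi>: "enumeration_operator \<Psi>"
    and \<Psi>_obj: "\<And>A. A \<in> C \<Longrightarrow> apply_enum \<Psi> (diagram L A) = diagram K (obj F A)"
    and pF: "computes_arrows L C F pF"
    using assms(3) by (auto simp: enumerable_functor_def)
  obtain pf f where stages: "stage_enumeration pf f"
    and enum: "\<And>L A. stage_enumeration.enumerated f (diagram L A) = apply_enum \<Psi> (diagram L A)"
    using enumeration_operator_stages[OF \<Psi>] by blast
  interpret stage_enumeration pf f by (rule stages)
  have loc: "enumerated_diagram pf f K (diagram L A) (obj F A)" if "A \<in> C" for A
    by standard (simp add: enum \<Psi>_obj that)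
  obtain sp ap where sp: "turing sp {} = char_fun (symbols K)"
    and ap: "\<And>i. i \<in> symbols K \<Longrightarrow> turing ap {} i = Some (arity K i)"
    using assms(2) by (auto simp: struct_class_def computable_lang_def computable_set_def)
  define t u where "t A = stage (diagram L A)" and "u A = fresh_elt (diagram L A)" for A
  define H where "H A = copy K (diagram L A) (obj F A)" for A
  define G where "G = \<lparr>obj = H, arr = (\<lambda>A B h. t B \<circ>\<^sub>m (arr F A B h \<circ>\<^sub>m u A))\<rparr>"
  have iso_t: "isomorphism K (obj F A) (H A) (t A)" if "A \<in> C" for A
    using enumerated_diagram.isomorphism_stage[OF loc[OF that]] by (simp add: H_def t_def)
  have iso_u: "isomorphism K (H A) (obj F A) (u A)" if "A \<in> C" for A
    using enumerated_diagram.isomorphism_fresh_elt[OF loc[OF that]] by (simp add: H_def u_def)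
  have ut: "u A \<circ>\<^sub>m t A = id_arrow (obj F A)" if "A \<in> C" for A
    using enumerated_diagram.fresh_elt_comp_stage[OF loc[OF that]] by (simp add: u_def t_def)
  have tu: "t A \<circ>\<^sub>m u A = id_arrow (H A)" if "A \<in> C" for A
    using enumerated_diagram.stage_comp_fresh_elt[OF loc[OF that]] by (simp add: u_def t_def H_def)
  \<comment> \<open>\<open>D\<close> is closed under isomorphism, and the copy is a structure
    isomorphic to a member of \<open>D\<close>.\<close>
  have "H A \<in> D" if "A \<in> C" for A
    using assms(2) F iso_t[OF that] that is_struct_copy[of K]
    unfolding struct_class_def is_functor_def H_def by blast
  then have functor_G: "is_functor L C K D G"
    unfolding G_def by (intro is_functor_conjugate[OF F] iso_t iso_u ut tu)

  have "turing (diagram_prog (subst_oracle Zero sp) (subst_oracle Zero ap)) (diagram L A) =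
      char_fun (diagram K (obj G A))" if "A \<in> C" for A
    using enumerated_diagram.turing_diagram_prog[OF loc[OF that],
        of "subst_oracle Zero sp" "subst_oracle Zero ap"] sp ap
    by (simp add: eval_subst_oracle_empty turing_def char_fun_def fun_eq_iff G_def H_def)
  moreover
  \<comment> \<open>A name is decoded with the source diagram, moved by \<open>pF\<close> with the
    whole arrow oracle, and renamed with the target diagram. Divergence at any point matches
    undefinedness of the composite.\<close>
  define q where "q = Comp (subst_oracle target_oracle_prog stage_prog)
    [Comp pF [subst_oracle source_oracle_prog fresh_elt_prog]]"
  have "computes_arrows L C G q"
    unfolding computes_arrows_def
  proof (intro ballI allI impI ext)
    fix A B h n
    assume AB: "A \<in> C" "B \<in> C" "isomorphism L A B h"
    then have "turing pF (arrow_oracle L A h B) = arr F A B h"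
      using pF by (simp add: computes_arrows_def)
    then have "eval_prog (arrow_oracle L A h B) pF [m] = arr F A B h m" for m
      by (simp add: turing_def fun_eq_iff)
    then show "turing q (arrow_oracle L A h B) n = arr G A B h n"
      by (simp add: q_def turing_def G_def t_def u_def eval_subst_oracle[OF eval_source_oracle_prog]
          eval_subst_oracle[OF eval_target_oracle_prog] map_comp_def split: option.split)
  qed
  ultimately have "computable_functor L C K D G"
    using functor_G unfolding computable_functor_def by blast
  moreover have "effectively_isomorphic L C K F G"
    unfolding effectively_isomorphic_def
  \<comment> \<open>The renaming \<open>t\<close> itself is the natural isomorphism, and
    \<open>stage_prog\<close> computes it uniformly in the diagram.\<close>
  proof (intro exI[of _ stage_prog] conjI ballI allI impI)
    have turing_stage: "turing stage_prog (diagram L A) = t A" for A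
      by (simp add: turing_def t_def)
    show "isomorphism K (obj F A) (obj G A) (turing stage_prog (diagram L A))" if "A \<in> C" for A
      using iso_t[OF that] by (simp add: turing_stage G_def)
    fix A B h
    assume AB: "A \<in> C" "B \<in> C" "isomorphism L A B h"
    then have "dom (arr F A B h) = universe (obj F A)"
      using F by (auto simp: is_functor_def isomorphism_def)
    \<comment> \<open>On the right, \<open>u A\<close> after \<open>t A\<close> cancels to the
      identity, which is absorbed because the domain of the arrow is the whole universe.\<close>
    then show "turing stage_prog (diagram L B) \<circ>\<^sub>m arr F A B h =
        arr G A B h \<circ>\<^sub>m turing stage_prog (diagram L A)"
      by (simp add: turing_stage G_def map_comp_assoc ut AB map_comp_id_arrow)
  qed
  ultimately show ?thesis by blast
qed

end
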